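(* Let $\mathcal{A}$ be a finite alphabet and $n\ge1$. If each of the nonempty sets $X_0,X_1,\dots,X_{n-1}\subseteq\mathcal{A}^{\mathbb{N}}$ has stable prefix entropy, then the $n$-fold interleaving $X=X_0\circledast X_1\circledast\cdots\circledast X_{n-1}$ also has stable prefix entropy. In addition $$H_p(X)=\frac1n\sum_{i=0}^{n-1}H_p(X_i).$$
   Context: $\mathbb{N}=\{0,1,2,\dots\}$. The $n$-fold interleaving of sequences $\mathbf{x}_i=a_{i,0}a_{i,1}\cdots\in\mathcal{A}^{\mathbb{N}}$ ($0\le i\le n-1$) is $b_0b_1b_2\cdots$ with $b_{i+jn}=a_{i,j}$ ($0\le i\le n-1$, $j\ge0$); the $n$-fold interleaving $X_0\circledast\cdots\circledast X_{n-1}$ of sets is the set of all $n$-fold interleavings of $(\mathbf{x}_0,\dots,\mathbf{x}_{n-1})$ with $\mathbf{x}_i\in X_i$. For $X\subseteq\mathcal{A}^{\mathbb{N}}$, $N_k^I(X)$ is the number of distinct prefix blocks $b_0b_1\cdots b_{k-1}$ of length $k$ of words $b_0b_1b_2\cdots\in X$, and the prefix entropy is $H_p(X)=\limsup_{k\to\infty}\frac1k\log N_k^I(X)$ (natural logarithm). $X$ has stable prefix entropy if the limit $\lim_{k\to\infty}\frac1k\log N_k^I(X)$ exists. *)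

theory Defs
  imports "HOL-Analysis.Analysis"
begin

definition interleave_words :: "nat \<Rightarrow> (nat \<Rightarrow> nat \<Rightarrow> 'a) \<Rightarrow> nat \<Rightarrow> 'a" where
  "interleave_words n x = (\<lambda>m. x (m mod n) (m div n))"

(* The usual description b_(i + j n) = a_(i,j); for n >= 1 it determines the word. *)
lemma interleave_words_nth:
  assumes "i < n"
  shows "interleave_words n x (i + j * n) = x i j"
  using assms by (simp add: interleave_words_def)

(* Only X 0, ..., X (n - 1) matter: the rows x i with i >= n are never read. *)
definition interleaving :: "nat \<Rightarrow> (nat \<Rightarrow> (nat \<Rightarrow> 'a) set) \<Rightarrow> (nat \<Rightarrow> 'a) set" where
  "interleaving n X = {interleave_words n x | x. \<forall>i<n. x i \<in> X i}"

definition prefix_block :: "nat \<Rightarrow> (nat \<Rightarrow> 'a) \<Rightarrow> 'a list" where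
  "prefix_block k w = map w [0..<k]"

definition num_prefix_blocks :: "nat \<Rightarrow> (nat \<Rightarrow> 'a) set \<Rightarrow> nat" where
  "num_prefix_blocks k X = card (prefix_block k ` X)"

(* The value at k = 0 is the junk value 0, which does not affect limits. *)
definition prefix_rate :: "(nat \<Rightarrow> 'a) set \<Rightarrow> nat \<Rightarrow> real" where
  "prefix_rate X k = 1 / real k * ln (real (num_prefix_blocks k X))"

(* Extended-real valued, so that the limsup is always a genuine one. For nonempty X
   over a finite alphabet A it is finite: 0 <= prefix_rate X k <= ln (card A) for k >= 1. *)
definition prefix_entropy :: "(nat \<Rightarrow> 'a) set \<Rightarrow> ereal" where
  "prefix_entropy X = limsup (\<lambda>k. ereal (prefix_rate X k))"

definition stable_prefix_entropy :: "(nat \<Rightarrow> 'a) set \<Rightarrow> bool" where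
  "stable_prefix_entropy X \<longleftrightarrow> convergent (prefix_rate X)"

end

theory Submission
  imports Defs
begin

text \<open>A prefix of length $k$ of an interleaved word consists of one freely chosen prefix of each
  component, of length $c_i(k) = \#\{j. \; i + jn < k\}$. Hence block counts multiply,
  $\log N_k(X) = \sum_i \log N_{c_i(k)}(X_i)$, and the claim follows from $c_i(k)/k \to 1/n$.\<close>

text \<open>Closed form of the count c_i(k): (k - i)/n rounded up, and 0 if k \<le> i. Adding
  \<open>n - 1\<close> before subtracting \<open>i\<close> keeps the truncated subtraction exact for
  i < n.\<close>

definition row_length :: "nat \<Rightarrow> nat \<Rightarrow> nat \<Rightarrow> nat" where
  "row_length n i k = (k + n - 1 - i) div n"

lemma less_row_length_iff:
  assumes "i < n"
  shows "j < row_length n i k \<longleftrightarrow> i + j * n < k"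
proof -
  have "j < row_length n i k \<longleftrightarrow> Suc j \<le> row_length n i k"
    by auto
  also have "\<dots> \<longleftrightarrow> Suc j * n \<le> k + n - 1 - i"
    using assms by (simp add: row_length_def less_eq_div_iff_mult_less_eq)
  also have "\<dots> \<longleftrightarrow> i + j * n < k"
    using assms by auto
  finally show ?thesis .
qed

lemma row_length_at_top:
  assumes "i < n"
  shows "filterlim (row_length n i) at_top at_top"
  unfolding filterlim_at_top
proof
  fix j
  show "eventually (\<lambda>k. j \<le> row_length n i k) at_top"
    using eventually_gt_at_top[of "i + j * n"]
    by eventually_elim (use less_row_length_iff[OF assms] in \<open>auto intro: less_imp_le\<close>)
qed

text \<open>Rounding and the offset i < n move c_i(k) by at most 1 away from k/n, so after division
  by k the error is at most 1/k.\<close>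

lemma row_length_density:
  assumes "i < n"
  shows "(\<lambda>k. real (row_length n i k) / real k) \<longlonglongrightarrow> 1 / real n"
proof -
  have bound: "\<bar>real (row_length n i k) / real k - 1 / real n\<bar> \<le> 1 / real k" if "k > 0" for k
  proof -
    let ?c = "row_length n i k"
    \<comment> \<open>Taking j = \<open>?c\<close> in the counting characterisation: the first index
      that is not counted lies at position \<open>i + ?c * n\<close>, which must be at least
      k.\<close>
    have "\<not> ?c < ?c"
      by simp
    then have lower: "k \<le> i + ?c * n"
      unfolding less_row_length_iff[OF assms] by simp
    have upper: "?c * n \<le> k + n - 1 - i"
      by (simp add: row_length_def)
    have "k \<le> n + ?c * n" "?c * n \<le> k + n"
      using lower upper assms by linarith+
    then have "real k \<le> real (n + ?c * n)" "real (?c * n) \<le> real (k + n)"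
      by (simp_all only: of_nat_le_iff)
    then have diff: "\<bar>real ?c * real n - real k\<bar> \<le> real n"
      by simp
    have "\<bar>real ?c / real k - 1 / real n\<bar> = \<bar>real ?c * real n - real k\<bar> / (real k * real n)"
      using that assms by (simp add: abs_divide diff_frac_eq abs_mult)
    also have "\<dots> \<le> real n / (real k * real n)"
      using diff by (rule divide_right_mono) simp
    also have "\<dots> = 1 / real k"
      using assms by simp
    finally show ?thesis .
  qed
  have "(\<lambda>k. real (row_length n i k) / real k - 1 / real n) \<longlonglongrightarrow> 0"
  proof (rule Lim_null_comparison)
    show "\<forall>\<^sub>F k in sequentially. norm (real (row_length n i k) / real k - 1 / real n) \<le> 1 / real k"
      using eventually_gt_at_top[of 0] by eventually_elim (use bound in simp)
    show "(\<lambda>k. 1 / real k) \<longlonglongrightarrow> 0"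
      by (rule lim_1_over_n)
  qed
  then show ?thesis
    by (simp add: LIM_zero_iff)
qed

lemma prefix_block_eq_iff: "prefix_block k v = prefix_block k w \<longleftrightarrow> (\<forall>m<k. v m = w m)"
  by (auto simp: prefix_block_def)

lemma length_prefix_block [simp]: "length (prefix_block k w) = k"
  by (simp add: prefix_block_def)

lemma nth_prefix_block [simp]: "m < k \<Longrightarrow> prefix_block k w ! m = w m"
  by (simp add: prefix_block_def)

text \<open>Cutting a k-prefix into its n rows gives a bijection with tuples of prefixes of the
  components, since the components are chosen independently. The inverse map \<open>f\<close> below
  reassembles such a tuple.\<close>

lemma num_prefix_blocks_interleaving:
  assumes "n \<ge> 1"
  shows "num_prefix_blocks k (interleaving n X)
    = (\<Prod>i<n. num_prefix_blocks (row_length n i k) (X i))"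
proof -
  define B where "B i = prefix_block (row_length n i k) ` X i" for i
  define f where "f g = prefix_block k (interleave_words n (\<lambda>i j. g i ! j))" for g :: "nat \<Rightarrow> 'a list"
  \<comment> \<open>Building a k-prefix never reads a list \<open>g i\<close> beyond its end, where
    \<open>!\<close> is unspecified.\<close>
  have row: "m div n < row_length n (m mod n) k" if "m < k" for m
    using that assms by (simp add: less_row_length_iff)
  have f_rows: "f g = prefix_block k (interleave_words n x)"
    if "\<And>i. i < n \<Longrightarrow> g i = prefix_block (row_length n i k) (x i)" for g x
    unfolding f_def prefix_block_eq_iff
    using that row assms by (simp add: interleave_words_def)
  have inj: "inj_on f (Pi\<^sub>E {..<n} B)"
  proof (rule inj_onI)
    fix g h
    assume g: "g \<in> Pi\<^sub>E {..<n} B" and h: "h \<in> Pi\<^sub>E {..<n} B" and eq: "f g = f h"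
    show "g = h"
    proof (rule PiE_ext[OF g h])
      fix i
      assume "i \<in> {..<n}"
      then have i: "i < n" "length (g i) = row_length n i k" "length (h i) = row_length n i k"
        using g h by (auto simp: B_def dest!: PiE_mem)
      show "g i = h i"
      proof (rule nth_equalityI)
        fix j
        assume "j < length (g i)"
        \<comment> \<open>Entry j of row i is visible in the k-prefix at this position, so equal
          images force equal rows.\<close>
        then have "i + j * n < k"
          using i less_row_length_iff by simp
        then have "interleave_words n (\<lambda>i j. g i ! j) (i + j * n)
            = interleave_words n (\<lambda>i j. h i ! j) (i + j * n)"
          using eq unfolding f_def prefix_block_eq_iff by blast
        then show "g i ! j = h i ! j"
          using i by (simp only: interleave_words_nth)
      qed (use i in simp)
    qed
  qed
  have image: "f ` Pi\<^sub>E {..<n} B = prefix_block k ` interleaving n X"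
  proof (intro equalityI subsetI)
    fix u
    assume "u \<in> f ` Pi\<^sub>E {..<n} B"
    then obtain g where g: "g \<in> Pi\<^sub>E {..<n} B" "u = f g"
      by blast
    \<comment> \<open>Each row prefix is extended to a full word of its component; interleaving
      these words realises the block.\<close>
    have "\<forall>i. \<exists>w. i < n \<longrightarrow> w \<in> X i \<and> g i = prefix_block (row_length n i k) w"
      using g(1) unfolding B_def by (fastforce dest: PiE_mem)
    then obtain x where "\<And>i. i < n \<Longrightarrow> x i \<in> X i \<and> g i = prefix_block (row_length n i k) (x i)"
      by metis
    then show "u \<in> prefix_block k ` interleaving n X"
      using g(2) f_rows[of g x] by (auto simp: interleaving_def)
  next
    fix u
    assume "u \<in> prefix_block k ` interleaving n X"
    then obtain x where x: "\<And>i. i < n \<Longrightarrow> x i \<in> X i" "u = prefix_block k (interleave_words n x)"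
      by (auto simp: interleaving_def)
    \<comment> \<open>The restricted lambda makes \<open>g\<close> extensional, as membership in
      \<open>Pi\<^sub>E\<close> demands.\<close>
    define g where "g = (\<lambda>i\<in>{..<n}. prefix_block (row_length n i k) (x i))"
    have "g \<in> Pi\<^sub>E {..<n} B"
      using x(1) by (auto simp: g_def B_def)
    moreover have "u = f g"
      using x(2) f_rows[of g x] by (simp add: g_def)
    ultimately show "u \<in> f ` Pi\<^sub>E {..<n} B"
      by blast
  qed
  have "num_prefix_blocks k (interleaving n X) = card (Pi\<^sub>E {..<n} B)"
    unfolding num_prefix_blocks_def image[symmetric] by (rule card_image[OF inj])
  also have "\<dots> = (\<Prod>i<n. card (B i))"
    by (simp add: card_PiE)
  finally show ?thesis
    by (simp add: B_def num_prefix_blocks_def)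
qed

text \<open>The finite alphabet enters here: it bounds the blocks of length k by finitely many
  lists, so \<open>card\<close> is a genuine count and not the default 0.\<close>

lemma num_prefix_blocks_pos:
  assumes "finite A" "X \<subseteq> UNIV \<rightarrow> A" "X \<noteq> {}"
  shows "num_prefix_blocks k X > 0"
proof -
  have "prefix_block k ` X \<subseteq> {u. set u \<subseteq> A \<and> length u = k}"
    using assms(2) by (fastforce simp: prefix_block_def)
  then have "finite (prefix_block k ` X)"
    using finite_lists_length_eq[OF assms(1)] finite_subset by blast
  then show ?thesis
    using assms(3) by (simp add: num_prefix_blocks_def card_gt_0_iff)
qed

text \<open>Includes k = 0, where the logarithm of the count vanishes; rows that are still empty
  therefore need no separate treatment.\<close>

lemma ln_num_prefix_blocks: "ln (real (num_prefix_blocks k X)) = real k * prefix_rate X k"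
proof (cases "k = 0")
  case True
  have "num_prefix_blocks 0 X \<in> {0, 1}"
    by (cases "X = {}") (simp_all add: num_prefix_blocks_def prefix_block_def image_constant_conv)
  then show ?thesis
    using True by auto
qed (simp add: prefix_rate_def)

text \<open>Writing each logarithm as length times rate splits every summand into two factors whose
  limits are known separately.\<close>

lemma prefix_rate_interleaving:
  assumes "n \<ge> 1" and "\<And>i k. i < n \<Longrightarrow> num_prefix_blocks k (X i) > 0"
  shows "prefix_rate (interleaving n X) k
    = (\<Sum>i<n. real (row_length n i k) / real k * prefix_rate (X i) (row_length n i k))"
proof -
  have "prefix_rate (interleaving n X) k = 1 / real k
      * (\<Sum>i<n. ln (real (num_prefix_blocks (row_length n i k) (X i))))"
    unfolding prefix_rate_def num_prefix_blocks_interleaving[OF assms(1)] of_nat_prod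
    by (subst ln_prod) (use assms(2) in auto)
  then show ?thesis
    by (simp add: ln_num_prefix_blocks sum_divide_distrib)
qed

lemma prefix_entropy_eq_lim:
  assumes "prefix_rate X \<longlonglongrightarrow> L"
  shows "prefix_entropy X = ereal L"
  unfolding prefix_entropy_def
  by (rule lim_imp_Limsup) (use assms in simp_all)

theorem theorem2p19:
  fixes A :: "'a set" and n :: nat and X :: "nat \<Rightarrow> (nat \<Rightarrow> 'a) set"
  assumes "finite A"
    and "n \<ge> 1"
    and "\<And>i. i < n \<Longrightarrow> X i \<subseteq> UNIV \<rightarrow> A"
    and "\<And>i. i < n \<Longrightarrow> X i \<noteq> {}"
    and "\<And>i. i < n \<Longrightarrow> stable_prefix_entropy (X i)"
  shows "stable_prefix_entropy (interleaving n X) \<and>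
    prefix_entropy (interleaving n X) = ereal (1 / real n) * (\<Sum>i<n. prefix_entropy (X i))"
proof -
  have "\<forall>i. \<exists>l. i < n \<longrightarrow> prefix_rate (X i) \<longlonglongrightarrow> l"
    using assms(5) unfolding stable_prefix_entropy_def convergent_def by blast
  then obtain L where L: "\<And>i. i < n \<Longrightarrow> prefix_rate (X i) \<longlonglongrightarrow> L i"
    by metis
  have rate: "prefix_rate (interleaving n X) = (\<lambda>k. \<Sum>i<n.
      real (row_length n i k) / real k * prefix_rate (X i) (row_length n i k))"
    using prefix_rate_interleaving[OF assms(2)] num_prefix_blocks_pos[OF assms(1,3,4)] by blast
  \<comment> \<open>The weights tend to 1/n, and each component rate is sampled along row lengths
    tending to infinity, so it keeps its limit \<open>L i\<close>.\<close>
  have lim: "prefix_rate (interleaving n X) \<longlonglongrightarrow> (\<Sum>i<n. 1 / real n * L i)"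
    unfolding rate
  proof (intro tendsto_sum tendsto_mult)
    fix i
    assume "i \<in> {..<n}"
    then have "i < n"
      by simp
    then show "(\<lambda>k. real (row_length n i k) / real k) \<longlonglongrightarrow> 1 / real n"
      and "(\<lambda>k. prefix_rate (X i) (row_length n i k)) \<longlonglongrightarrow> L i"
      using row_length_density filterlim_compose[OF L row_length_at_top] by blast+
  qed
  \<comment> \<open>All the limits are real, so the identity is a real one carried over to
    \<open>ereal\<close>.\<close>
  have "prefix_entropy (interleaving n X) = ereal (1 / real n) * ereal (\<Sum>i<n. L i)"
    using prefix_entropy_eq_lim[OF lim] by (simp add: sum_divide_distrib)
  also have "ereal (\<Sum>i<n. L i) = (\<Sum>i<n. prefix_entropy (X i))"
    using prefix_entropy_eq_lim[OF L] by simp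
  finally show ?thesis
    using lim by (auto simp: stable_prefix_entropy_def convergent_def)
qed

end
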